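(* Assume that $\operatorname{dom}Ef\cap(\mathcal X\times\mathcal U)\neq\emptyset$, i.e. there is $(x,u)\in\mathcal X\times\mathcal U$ with $Ef(x,u)<\infty$. Then the dual problem $$\text{maximize}\quad \langle \bar u,y\rangle-F^*(0,p,y)\quad\text{over } (p,y)\in\mathcal V\times\mathcal Y$$ can be written as $$\text{maximize}\quad \langle \bar u,y\rangle-Ef^*(p,y)\quad\text{over } (p,y)\in\mathcal X_a^\perp\times\mathcal Y,$$ that is, for $(p,y)\in\mathcal V\times\mathcal Y$ the objective $\langle \bar u,y\rangle-F^*(0,p,y)$ equals $\langle\bar u,y\rangle-Ef^*(p,y)$ if $p\in\mathcal X_a^\perp$ and equals $-\infty$ otherwise.
   Context: $(\Omega,\mathcal F,P)$ is a probability space with a filtration $(\mathcal F_t)_{t=0}^T$ (an increasing sequence of sub-$\sigma$-algebras of $\mathcal F$). $n=n_0+\dots+n_T$ and $\mathcal N$ is the linear space of all $x=(x_t)_{t=0}^T\in L^0(\mathbb R^n)$ such that $x_t$ is $\mathbb R^{n_t}$-valued and $\mathcal F_t$-measurable for every $t$. Random variables equal a.s. are identified. Convention: the expectation of an extended real-valued random variable is $+\infty$ unless its positive part is integrable. $f$ is a convex normal integrand on $\mathbb R^n\times\mathbb R^m\times\Omega$: $f(\cdot,\omega)$ is a closed convex extended real-valued function for every $\omega$ (closed: lower semicontinuous and either proper or identically $+\infty$ or identically $-\infty$) and $\omega\mapsto\operatorname{epi}f(\cdot,\omega)$ is a measurable set-valued mapping. $Ef(x,u):=\int f(x(\omega),u(\omega),\omega)\,dP(\omega)$;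 $f^*(v,y,\omega):=\sup_{x,u}\{x\cdot v+u\cdot y-f(x,u,\omega)\}$ and $Ef^*$ is the corresponding integral functional. A linear space $\mathcal U$ of $\mathbb R^m$-valued random variables is decomposable if $1_Au+1_{\Omega\setminus A}u'\in\mathcal U$ for all $u\in\mathcal U$, $u'\in L^\infty$, $A\in\mathcal F$; it is solid if $\bar u\in\mathcal U$, $u\in L^0$ and $|u^i|\le|\bar u^i|$ a.s. for all components $i$ imply $u\in\mathcal U$. $\mathcal X,\mathcal V$ are solid decomposable spaces of $\mathbb R^n$-valued random variables in separating duality under $\langle x,v\rangle:=E[x\cdot v]$ and $\mathcal U,\mathcal Y$ are solid decomposable spaces of $\mathbb R^m$-valued random variables in separating duality under $\langle u,y\rangle:=E[u\cdot y]$ (in particular the products are integrable). $\bar u\in\mathcal U$ is fixed. $\mathcal X_a:=\mathcal X\cap\mathcal N$ and $\mathcal X_a^\perp:=\{v\in\mathcal V: \langle x,v\rangle=0\ \forall x\in\mathcal X_a\}$. $F(x,z,u):=Ef(x,u)+\delta_{\mathcal N}(x-z)$ on $\mathcal X\times\mathcal X\times\mathcal U$, where $\delta_{\mathcal N}$ is $0$ on $\mathcal N$ and $+\infty$ elsewhere (a sum involving $+\infty$ is $+\infty$), and $F^*(v,p,y):=\sup_{x\in\mathcal X,z\in\mathcal X,u\in\mathcal U}\{\langle x,v\rangle+\langle z,p\rangle+\langle u,y\rangle-F(x,z,u)\}$ for $(v,p,y)\in\mathcal V\times\mathcal V\times\mathcal Y$. *)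

theory Defs
  imports "HOL-Probability.Probability"
begin

text \<open>
  Random variables are functions on \<open>space M\<close>; the identification of a.s. equal ones is expressed
  by working with sets of functions that are closed under a.s. equality (solid spaces are, and
  \<open>adapted_processes\<close> below is defined that way).
\<close>

section \<open>Expectations of extended real-valued random variables\<close>

text \<open>\<open>e2ennreal\<close> maps negative values to \<open>0\<close>, so the two integrals are those of the positive and
  of the negative part.\<close>

definition ext_expectation :: "'a measure \<Rightarrow> ('a \<Rightarrow> ereal) \<Rightarrow> ereal" where
  "ext_expectation M X =
    (if (\<integral>\<^sup>+\<omega>. e2ennreal (X \<omega>) \<partial>M) < \<infinity>
     then enn2ereal (\<integral>\<^sup>+\<omega>. e2ennreal (X \<omega>) \<partial>M) - enn2ereal (\<integral>\<^sup>+\<omega>. e2ennreal (- X \<omega>) \<partial>M)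
     else \<infinity>)"

definition integral_functional ::
  "'a measure \<Rightarrow> ('b \<Rightarrow> 'c \<Rightarrow> 'a \<Rightarrow> ereal) \<Rightarrow> ('a \<Rightarrow> 'b) \<Rightarrow> ('a \<Rightarrow> 'c) \<Rightarrow> ereal" where
  "integral_functional M h x u = ext_expectation M (\<lambda>\<omega>. h (x \<omega>) (u \<omega>) \<omega>)"

section \<open>Convex normal integrands\<close>

definition ereal_epigraph :: "('b \<Rightarrow> ereal) \<Rightarrow> ('b \<times> real) set" where
  "ereal_epigraph h = {(z, r). h z \<le> ereal r}"

definition lower_semicontinuous :: "('b::topological_space \<Rightarrow> ereal) \<Rightarrow> bool" where
  "lower_semicontinuous h \<longleftrightarrow> (\<forall>c. open {z. c < h z})"

definition proper_function :: "('b \<Rightarrow> ereal) \<Rightarrow> bool" where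
  "proper_function h \<longleftrightarrow> (\<forall>z. h z \<noteq> -\<infinity>) \<and> (\<exists>z. h z \<noteq> \<infinity>)"

definition closed_function :: "('b::topological_space \<Rightarrow> ereal) \<Rightarrow> bool" where
  "closed_function h \<longleftrightarrow> lower_semicontinuous h \<and>
    (proper_function h \<or> (\<forall>z. h z = \<infinity>) \<or> (\<forall>z. h z = -\<infinity>))"

definition convex_function :: "('b::real_vector \<Rightarrow> ereal) \<Rightarrow> bool" where
  "convex_function h \<longleftrightarrow> convex (ereal_epigraph h)"

definition measurable_set_valued :: "'a measure \<Rightarrow> ('a \<Rightarrow> 'b::topological_space set) \<Rightarrow> bool" where
  "measurable_set_valued M S \<longleftrightarrow> (\<forall>G. open G \<longrightarrow> {\<omega> \<in> space M. S \<omega> \<inter> G \<noteq> {}} \<in> sets M)"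

definition convex_normal_integrand ::
  "'a measure \<Rightarrow> ('b::euclidean_space \<Rightarrow> 'c::euclidean_space \<Rightarrow> 'a \<Rightarrow> ereal) \<Rightarrow> bool" where
  "convex_normal_integrand M f \<longleftrightarrow>
    (\<forall>\<omega>\<in>space M. closed_function (\<lambda>(x, u). f x u \<omega>) \<and> convex_function (\<lambda>(x, u). f x u \<omega>)) \<and>
    measurable_set_valued M (\<lambda>\<omega>. ereal_epigraph (\<lambda>(x, u). f x u \<omega>))"

definition conjugate_integrand ::
  "('b::real_inner \<Rightarrow> 'c::real_inner \<Rightarrow> 'a \<Rightarrow> ereal) \<Rightarrow> 'b \<Rightarrow> 'c \<Rightarrow> 'a \<Rightarrow> ereal" where
  "conjugate_integrand f v y \<omega> = (SUP (x, u). ereal (x \<bullet> v + u \<bullet> y) - f x u \<omega>)"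

section \<open>Spaces of random variables\<close>

definition rv_linear_space :: "'a measure \<Rightarrow> ('a \<Rightarrow> real ^ 'k) set \<Rightarrow> bool" where
  "rv_linear_space M U \<longleftrightarrow> U \<subseteq> borel_measurable M \<and> (\<lambda>\<omega>. 0) \<in> U \<and>
    (\<forall>u\<in>U. \<forall>u'\<in>U. (\<lambda>\<omega>. u \<omega> + u' \<omega>) \<in> U) \<and> (\<forall>c. \<forall>u\<in>U. (\<lambda>\<omega>. c *\<^sub>R u \<omega>) \<in> U)"

definition ess_bounded :: "'a measure \<Rightarrow> ('a \<Rightarrow> real ^ 'k) set" where
  "ess_bounded M = {u \<in> borel_measurable M. \<exists>C. AE \<omega> in M. norm (u \<omega>) \<le> C}"

definition decomposable :: "'a measure \<Rightarrow> ('a \<Rightarrow> real ^ 'k) set \<Rightarrow> bool" where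
  "decomposable M U \<longleftrightarrow> (\<forall>u\<in>U. \<forall>u'\<in>ess_bounded M. \<forall>A\<in>sets M.
    (\<lambda>\<omega>. indicator A \<omega> *\<^sub>R u \<omega> + indicator (space M - A) \<omega> *\<^sub>R u' \<omega>) \<in> U)"

definition solid :: "'a measure \<Rightarrow> ('a \<Rightarrow> real ^ 'k) set \<Rightarrow> bool" where
  "solid M U \<longleftrightarrow> (\<forall>w\<in>U. \<forall>u\<in>borel_measurable M.
    (AE \<omega> in M. \<forall>i. \<bar>u \<omega> $ i\<bar> \<le> \<bar>w \<omega> $ i\<bar>) \<longrightarrow> u \<in> U)"

definition solid_decomposable_space :: "'a measure \<Rightarrow> ('a \<Rightarrow> real ^ 'k) set \<Rightarrow> bool" where
  "solid_decomposable_space M U \<longleftrightarrow> rv_linear_space M U \<and> decomposable M U \<and> solid M U"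

definition pairing :: "'a measure \<Rightarrow> ('a \<Rightarrow> real ^ 'k) \<Rightarrow> ('a \<Rightarrow> real ^ 'k) \<Rightarrow> real" where
  "pairing M x v = (\<integral>\<omega>. x \<omega> \<bullet> v \<omega> \<partial>M)"

definition separating_duality ::
  "'a measure \<Rightarrow> ('a \<Rightarrow> real ^ 'k) set \<Rightarrow> ('a \<Rightarrow> real ^ 'k) set \<Rightarrow> bool" where
  "separating_duality M X V \<longleftrightarrow>
    (\<forall>x\<in>X. \<forall>v\<in>V. integrable M (\<lambda>\<omega>. x \<omega> \<bullet> v \<omega>)) \<and>
    (\<forall>x\<in>X. (\<forall>v\<in>V. pairing M x v = 0) \<longrightarrow> (AE \<omega> in M. x \<omega> = 0)) \<and>
    (\<forall>v\<in>V. (\<forall>x\<in>X. pairing M x v = 0) \<longrightarrow> (AE \<omega> in M. v \<omega> = 0))"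

section \<open>Adapted processes\<close>

definition discrete_filtration :: "'a measure \<Rightarrow> nat \<Rightarrow> (nat \<Rightarrow> 'a measure) \<Rightarrow> bool" where
  "discrete_filtration M T F \<longleftrightarrow>
    (\<forall>t\<le>T. subalgebra M (F t)) \<and> (\<forall>t\<le>T. \<forall>s\<le>t. sets (F s) \<subseteq> sets (F t))"

text \<open>
  The splitting \<open>n = n\<^sub>0 + \<dots> + n\<^sub>T\<close> of the coordinates is given by a map \<open>stage\<close> from
  coordinate indices to \<open>{0..T}\<close>: the block \<open>x\<^sub>t\<close> consists of the components \<open>x $ i\<close> with
  \<open>stage i = t\<close>, so that \<open>n\<^sub>t = card {i. stage i = t}\<close>. The version \<open>x'\<close> accounts for the
  identification of a.s. equal random variables.
\<close>

definition adapted_processes ::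
  "'a measure \<Rightarrow> nat \<Rightarrow> (nat \<Rightarrow> 'a measure) \<Rightarrow> ('n::finite \<Rightarrow> nat) \<Rightarrow> ('a \<Rightarrow> real ^ 'n) set" where
  "adapted_processes M T F stage = {x \<in> borel_measurable M.
    \<exists>x'. (AE \<omega> in M. x \<omega> = x' \<omega>) \<and>
      (\<forall>t\<le>T. \<forall>i. stage i = t \<longrightarrow> (\<lambda>\<omega>. x' \<omega> $ i) \<in> borel_measurable (F t))}"

definition annihilator ::
  "'a measure \<Rightarrow> ('a \<Rightarrow> real ^ 'k) set \<Rightarrow> ('a \<Rightarrow> real ^ 'k) set \<Rightarrow> ('a \<Rightarrow> real ^ 'k) set" where
  "annihilator M V C = {v \<in> V. \<forall>x\<in>C. pairing M x v = 0}"

section \<open>The perturbation function and its conjugate\<close>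

text \<open>Addition on \<open>ereal\<close> satisfies \<open>\<infinity> + a = a + \<infinity> = \<infinity>\<close> for every \<open>a\<close>, including \<open>-\<infinity>\<close>.\<close>

definition convex_indicator :: "'b set \<Rightarrow> 'b \<Rightarrow> ereal" where
  "convex_indicator C z = (if z \<in> C then 0 else \<infinity>)"

definition perturbation_function ::
  "'a measure \<Rightarrow> ('a \<Rightarrow> real ^ 'n) set \<Rightarrow> (real ^ 'n \<Rightarrow> real ^ 'm \<Rightarrow> 'a \<Rightarrow> ereal)
    \<Rightarrow> ('a \<Rightarrow> real ^ 'n) \<Rightarrow> ('a \<Rightarrow> real ^ 'n) \<Rightarrow> ('a \<Rightarrow> real ^ 'm) \<Rightarrow> ereal" where
  "perturbation_function M N f x z u =
    integral_functional M f x u + convex_indicator N (\<lambda>\<omega>. x \<omega> - z \<omega>)"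

definition perturbation_conjugate ::
  "'a measure \<Rightarrow> ('a \<Rightarrow> real ^ 'n) set \<Rightarrow> ('a \<Rightarrow> real ^ 'm) set
    \<Rightarrow> (('a \<Rightarrow> real ^ 'n) \<Rightarrow> ('a \<Rightarrow> real ^ 'n) \<Rightarrow> ('a \<Rightarrow> real ^ 'm) \<Rightarrow> ereal)
    \<Rightarrow> ('a \<Rightarrow> real ^ 'n) \<Rightarrow> ('a \<Rightarrow> real ^ 'n) \<Rightarrow> ('a \<Rightarrow> real ^ 'm) \<Rightarrow> ereal" where
  "perturbation_conjugate M X U G v p y =
    (SUP (x, z, u) \<in> X \<times> X \<times> U.
      ereal (pairing M x v + pairing M z p + pairing M u y) - G x z u)"

end

(*
  If p does not annihilate the adapted processes, moving z along an adapted direction makes the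
  conjugate infinite. If it does, z can be replaced by x, and what remains is the interchange of
  supremum and integral for E[x.p + u.y - f(x,u)]. For the latter, the projections of a countable
  dense set onto the epigraph of f form a Castaing representation; splicing bounded pieces of it
  into a point of dom Ef, wherever this increases the integrand, gives an increasing sequence in
  the product of X and U whose pointwise supremum is f*, and monotone convergence applies.
*)

theory Submission
  imports Defs
begin

text \<open>The obstacle is the one-sided convention for expectations: if neither the positive nor
  the negative part of f(x,u) is integrable, then <x,p> + <u,y> - Ef(x,u) is -infinity while
  E[x.p + u.y - f(x,u)] is +infinity. The two agree when Ef(x,u) is below infinity, so the
  maximizing sequence must never leave dom Ef. Replacing values only where this is an improvement
  ensures it: at the starting point x.p + u.y - f(x,u) has an integrable minorant, which survives
  every replacement and turns into an integrable majorant of f(x,u). The same minorant licenses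
  monotone convergence. The pieces are bounded because decomposability admits only essentially
  bounded insertions; countably many truncation levels recover each member of the representation
  pointwise. The epigraph is represented because x.p + u.y - r is continuous in (x,u,r), so that
  density suffices without continuity of f. Convexity makes the projections single-valued and
  nonexpansive, from which their measurability is derived.\<close>

lemma closed_ereal_epigraph:
  fixes h :: "'b::topological_space \<Rightarrow> ereal"
  assumes "lower_semicontinuous h"
  shows "closed (ereal_epigraph h)"
proof -
  \<comment> \<open>Off the epigraph some real \<open>c\<close> lies strictly between the height of
    the point and the value of \<open>h\<close>, even where \<open>h\<close> is infinite; this makes
    the complement a union of open products.\<close>
  have "- ereal_epigraph h = (\<Union>c. {z. ereal c < h z} \<times> {..<c})"
  proof (intro set_eqI iffI)
    fix p assume "p \<in> - ereal_epigraph h"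
    then have "ereal (snd p) < h (fst p)"
      by (auto simp: ereal_epigraph_def not_le split: prod.splits)
    then obtain c where "ereal (snd p) < ereal c" "ereal c < h (fst p)"
      using ereal_dense2 by blast
    then show "p \<in> (\<Union>c. {z. ereal c < h z} \<times> {..<c})"
      by (auto simp: mem_Times_iff)
  next
    fix p assume "p \<in> (\<Union>c. {z. ereal c < h z} \<times> {..<c})"
    then obtain c where c: "ereal c < h (fst p)" "snd p < c" by auto
    then have "ereal (snd p) < h (fst p)"
      by (meson ereal_less_le less_ereal.simps(1) less_imp_le le_less_trans)
    then show "p \<in> - ereal_epigraph h"
      by (auto simp: ereal_epigraph_def not_le split: prod.splits)
  qed
  moreover have "open (\<Union>c. {z. ereal c < h z} \<times> {..<c})"
    using assms unfolding lower_semicontinuous_def by (intro open_UN ballI open_Times) auto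
  ultimately show ?thesis by (simp add: closed_open)
qed

section \<open>Measurable selections of closed convex sets\<close>

text \<open>A point lies outside a closed set iff some basic open set contains it and misses the
  set. With a countable basis this is a countable union of measurable events.\<close>

lemma measurable_mem_closed_set_valued:
  fixes S :: "'a \<Rightarrow> 'b::second_countable_topology set"
  assumes S: "measurable_set_valued M S" "\<And>\<omega>. \<omega> \<in> space M \<Longrightarrow> closed (S \<omega>)"
    and q: "q \<in> borel_measurable M"
  shows "{\<omega> \<in> space M. q \<omega> \<in> S \<omega>} \<in> sets M"
proof -
  obtain B :: "'b set set" where B: "countable B" "topological_basis B"
    using ex_countable_basis by blast
  let ?N = "\<Union>G\<in>B. {\<omega> \<in> space M. q \<omega> \<in> G} - {\<omega> \<in> space M. S \<omega> \<inter> G \<noteq> {}}"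
  have "{\<omega> \<in> space M. q \<omega> \<in> G} - {\<omega> \<in> space M. S \<omega> \<inter> G \<noteq> {}} \<in> sets M" if "G \<in> B" for G
  proof (rule sets.Diff)
    have "open G" using B that topological_basis_open by blast
    then show "{\<omega> \<in> space M. S \<omega> \<inter> G \<noteq> {}} \<in> sets M"
      using S(1) by (auto simp: measurable_set_valued_def)
    have "q -` G \<inter> space M \<in> sets M"
      using q \<open>open G\<close> by (intro measurable_sets) auto
    moreover have "q -` G \<inter> space M = {\<omega> \<in> space M. q \<omega> \<in> G}" by auto
    ultimately show "{\<omega> \<in> space M. q \<omega> \<in> G} \<in> sets M" by simp
  qed
  then have "?N \<in> sets M" using B(1) by (intro sets.countable_UN') auto
  moreover have "{\<omega> \<in> space M. q \<omega> \<in> S \<omega>} = space M - ?N"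
  proof (intro set_eqI iffI)
    fix \<omega> assume \<omega>: "\<omega> \<in> space M - ?N"
    then have "open (- S \<omega>)" using S(2) by (intro open_Compl) simp
    have "q \<omega> \<in> S \<omega>"
    proof (rule ccontr)
      assume "q \<omega> \<notin> S \<omega>"
      then have "q \<omega> \<in> - S \<omega>" by simp
      then obtain G where "G \<in> B" "q \<omega> \<in> G" "G \<subseteq> - S \<omega>"
        by (rule topological_basisE[OF B(2) \<open>open (- S \<omega>)\<close>])
      then show False using \<omega> by auto
    qed
    then show "\<omega> \<in> {\<omega> \<in> space M. q \<omega> \<in> S \<omega>}" using \<omega> by simp
  qed auto
  ultimately show ?thesis by auto
qed

text \<open>The distance is below \<open>c\<close> exactly when the open ball of radius
  \<open>c\<close> hits the set. Nonempty values exclude the default 0 of \<open>infdist\<close> for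
  the empty set.\<close>

lemma measurable_infdist_set_valued:
  fixes S :: "'a \<Rightarrow> 'b::metric_space set"
  assumes "measurable_set_valued M S" "\<And>\<omega>. \<omega> \<in> space M \<Longrightarrow> S \<omega> \<noteq> {}"
  shows "(\<lambda>\<omega>. infdist q (S \<omega>)) \<in> borel_measurable M"
proof (rule borel_measurableI_less)
  fix c
  have "{\<omega> \<in> space M. infdist q (S \<omega>) < c} = {\<omega> \<in> space M. S \<omega> \<inter> ball q c \<noteq> {}}"
    using assms(2) by (auto simp: infdist_def cINF_less_iff)
  then show "{\<omega> \<in> space M. infdist q (S \<omega>) < c} \<in> sets M"
    using assms(1) by (simp add: measurable_set_valued_def)
qed

text \<open>
  The gradient of half the squared distance to \<open>S\<close> is \<open>q - closest_point S q\<close>: this exhibits the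
  projection onto a measurable set-valued map as a limit of measurable functions.
\<close>

lemma closest_point_gradient_LIMSEQ:
  fixes S :: "'b::euclidean_space set"
  assumes S: "closed S" "convex S" "S \<noteq> {}"
  shows "(\<lambda>n. ((infdist (q + (1 / real (Suc n)) *\<^sub>R e) S)\<^sup>2 - (infdist q S)\<^sup>2) * real (Suc n))
    \<longlonglongrightarrow> 2 * (e \<bullet> (q - closest_point S q))"
proof -
  let ?P = "closest_point S"
  have P: "infdist r S = norm (r - ?P r)" for r
    using setdist_closest_point[OF S(1,3), of r] by (simp add: infdist_eq_setdist dist_norm)
  have le: "infdist r S \<le> norm (r - s)" if "s \<in> S" for r s
    using infdist_le[OF that, of r] by (simp add: dist_norm)
  have sq: "(norm (a + t *\<^sub>R e))\<^sup>2 = (norm a)\<^sup>2 + 2 * t * (e \<bullet> a) + t\<^sup>2 * (norm e)\<^sup>2" for a :: 'b and t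
    unfolding power2_norm_eq_inner using inner_commute[of a e]
    by (simp add: inner_add_left inner_add_right power2_eq_square algebra_simps)
  have *: "\<bar>((infdist (q + t *\<^sub>R e) S)\<^sup>2 - (infdist q S)\<^sup>2) / t - 2 * (e \<bullet> (q - ?P q))\<bar>
      \<le> t * (norm e)\<^sup>2" if "t > 0" for t
  proof -
    let ?q = "q + t *\<^sub>R e" and ?D = "(infdist (q + t *\<^sub>R e) S)\<^sup>2 - (infdist q S)\<^sup>2"
    \<comment> \<open>\<open>?P q\<close> competes for the distance from the shifted point, which
      yields the upper bound.\<close>
    have "(infdist ?q S)\<^sup>2 \<le> (norm ((q - ?P q) + t *\<^sub>R e))\<^sup>2"
      using le[of "?P q" ?q] closest_point_in_set[OF S(1,3)]
      by (intro power_mono) (auto simp: algebra_simps infdist_nonneg)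
    then have up: "?D \<le> 2 * t * (e \<bullet> (q - ?P q)) + t\<^sup>2 * (norm e)\<^sup>2"
      unfolding P[of q] sq by simp
    \<comment> \<open>Conversely, the projection of the shifted point competes for the distance from
      \<open>q\<close>; the lower bound then contains the residual at \<open>?q\<close> instead of
      the one at \<open>q\<close>.\<close>
    have "(infdist q S)\<^sup>2 \<le> (norm ((?q - ?P ?q) + (-t) *\<^sub>R e))\<^sup>2"
      using le[of "?P ?q" q] closest_point_in_set[OF S(1,3)]
      by (intro power_mono) (auto simp: algebra_simps infdist_nonneg)
    then have "?D \<ge> 2 * t * (e \<bullet> (?q - ?P ?q)) - t\<^sup>2 * (norm e)\<^sup>2"
      unfolding P[of ?q] sq by simp
    \<comment> \<open>Convexity enters here: the projection is nonexpansive, so along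
      \<open>e\<close> it cannot outrun the shift from \<open>q\<close> to
      \<open>?q\<close>.\<close>
    moreover have "e \<bullet> (?q - ?P ?q) \<ge> e \<bullet> (q - ?P q)"
    proof -
      have "\<bar>e \<bullet> (?P ?q - ?P q)\<bar> \<le> norm e * norm (?P ?q - ?P q)"
        by (rule Cauchy_Schwarz_ineq2)
      also have "\<dots> \<le> norm e * (t * norm e)"
        using closest_point_lipschitz[OF S(2,1,3), of ?q q] that
        by (intro mult_left_mono) (auto simp: dist_norm)
      also have "\<dots> = t * (e \<bullet> e)"
        by (simp add: dot_square_norm power2_eq_square)
      finally show ?thesis by (simp add: inner_diff_right inner_add_right)
    qed
    then have "2 * t * (e \<bullet> (?q - ?P ?q)) \<ge> 2 * t * (e \<bullet> (q - ?P q))"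
      using that by simp
    ultimately have low: "?D \<ge> 2 * t * (e \<bullet> (q - ?P q)) - t\<^sup>2 * (norm e)\<^sup>2" by linarith
    have "\<bar>?D - t * (2 * (e \<bullet> (q - ?P q)))\<bar> \<le> t * (t * (norm e)\<^sup>2)"
      using up low by (simp add: power2_eq_square abs_le_iff algebra_simps)
    moreover have "?D / t - 2 * (e \<bullet> (q - ?P q)) = (?D - t * (2 * (e \<bullet> (q - ?P q)))) / t"
      using that by (simp add: field_simps)
    ultimately show ?thesis
      using that by (simp add: abs_divide divide_le_eq mult.commute del: times_divide_eq_left)
  qed
  have "(\<lambda>n. 1 / real (Suc n) * (norm e)\<^sup>2) \<longlonglongrightarrow> 0 * (norm e)\<^sup>2"
    by (intro tendsto_mult tendsto_const) (rule LIMSEQ_Suc[OF lim_1_over_n])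
  then have "(\<lambda>n. 1 / real (Suc n) * (norm e)\<^sup>2) \<longlonglongrightarrow> 0" by simp
  then have "(\<lambda>n. ((infdist (q + (1 / real (Suc n)) *\<^sub>R e) S)\<^sup>2 - (infdist q S)\<^sup>2) * real (Suc n)
      - 2 * (e \<bullet> (q - ?P q))) \<longlonglongrightarrow> 0"
  proof (rule Lim_null_comparison[rotated], intro always_eventually allI)
    fix n
    show "norm (((infdist (q + (1 / real (Suc n)) *\<^sub>R e) S)\<^sup>2 - (infdist q S)\<^sup>2)
        * real (Suc n) - 2 * (e \<bullet> (q - ?P q))) \<le> 1 / real (Suc n) * (norm e)\<^sup>2"
      using *[of "1 / real (Suc n)"] by (simp del: of_nat_Suc)
  qed
  then show ?thesis by (rule LIM_zero_cancel)
qed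

lemma measurable_closest_point:
  fixes S :: "'a \<Rightarrow> 'b::euclidean_space set"
  assumes "measurable_set_valued M S"
    and S: "\<And>\<omega>. \<omega> \<in> space M \<Longrightarrow> closed (S \<omega>) \<and> convex (S \<omega>) \<and> S \<omega> \<noteq> {}"
  shows "(\<lambda>\<omega>. closest_point (S \<omega>) q) \<in> borel_measurable M"
proof (subst borel_measurable_euclidean_space, intro ballI)
  fix e :: 'b
  have [measurable]: "(\<lambda>\<omega>. infdist r (S \<omega>)) \<in> borel_measurable M" for r
    using S by (intro measurable_infdist_set_valued assms) auto
  have "(\<lambda>\<omega>. 2 * (e \<bullet> (q - closest_point (S \<omega>) q))) \<in> borel_measurable M"
    by (rule borel_measurable_LIMSEQ_real[OF closest_point_gradient_LIMSEQ]) (use S in auto)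
  then have "(\<lambda>\<omega>. q \<bullet> e - 2 * (e \<bullet> (q - closest_point (S \<omega>) q)) / 2) \<in> borel_measurable M"
    by (intro borel_measurable_diff borel_measurable_divide) auto
  then show "(\<lambda>\<omega>. closest_point (S \<omega>) q \<bullet> e) \<in> borel_measurable M"
    by (simp add: inner_diff_right inner_commute diff_divide_distrib)
qed

text \<open>Projecting a countable dense set keeps density: a dense point within e/2 of some
  \<open>s\<close> in the set is at most that far from its own projection, since \<open>s\<close>
  competes, so the projection is within e of \<open>s\<close>.\<close>

lemma Castaing_representation:
  fixes S :: "'a \<Rightarrow> 'b::euclidean_space set"
  assumes meas: "measurable_set_valued M S"
    and S: "\<And>\<omega>. \<omega> \<in> space M \<Longrightarrow> closed (S \<omega>) \<and> convex (S \<omega>)"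
  obtains a :: "nat \<Rightarrow> 'a \<Rightarrow> 'b"
  where "\<And>m. a m \<in> borel_measurable M"
    and "\<And>\<omega> m. \<omega> \<in> space M \<Longrightarrow> S \<omega> \<noteq> {} \<Longrightarrow> a m \<omega> \<in> S \<omega>"
    and "\<And>\<omega>. \<omega> \<in> space M \<Longrightarrow> S \<omega> \<subseteq> closure (range (\<lambda>m. a m \<omega>))"
proof -
  \<comment> \<open>An empty value has no projection. Filling it with the whole space preserves
    measurability and closed convexity, and the last two claims hold trivially at such
    \<open>\<omega>\<close>.\<close>
  define R where "R \<omega> = (if S \<omega> = {} then UNIV else S \<omega>)" for \<omega>
  have "measurable_set_valued M R"
    unfolding measurable_set_valued_def
  proof (intro allI impI)
    fix G :: "'b set" assume G: "open G"
    have S_sets: "{\<omega> \<in> space M. S \<omega> \<inter> H \<noteq> {}} \<in> sets M" if "open H" for H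
      using meas that by (simp add: measurable_set_valued_def)
    have "{\<omega> \<in> space M. R \<omega> \<inter> G \<noteq> {}} = {\<omega> \<in> space M. S \<omega> \<inter> G \<noteq> {}} \<union>
        (if G = {} then {} else space M - {\<omega> \<in> space M. S \<omega> \<inter> UNIV \<noteq> {}})"
      by (auto simp: R_def)
    also have "\<dots> \<in> sets M"
      using S_sets[OF G] S_sets[OF open_UNIV] by (cases "G = {}") auto
    finally show "{\<omega> \<in> space M. R \<omega> \<inter> G \<noteq> {}} \<in> sets M" .
  qed
  have R: "closed (R \<omega>) \<and> convex (R \<omega>) \<and> R \<omega> \<noteq> {}" if "\<omega> \<in> space M" for \<omega>
    using S[OF that] by (auto simp: R_def)
  obtain D :: "'b set" where D: "countable D" "\<And>G. open G \<Longrightarrow> G \<noteq> {} \<Longrightarrow> \<exists>d\<in>D. d \<in> G"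
    using countable_dense_exists by metis
  have "D \<noteq> {}" using D(2)[of UNIV] by auto
  define a where "a m \<omega> = closest_point (R \<omega>) (from_nat_into D m)" for m \<omega>
  show ?thesis
  proof
    show "a m \<in> borel_measurable M" for m
      unfolding a_def[abs_def]
      by (rule measurable_closest_point[OF \<open>measurable_set_valued M R\<close> R])
    show "a m \<omega> \<in> S \<omega>" if "\<omega> \<in> space M" "S \<omega> \<noteq> {}" for \<omega> m
      using closest_point_in_set[of "R \<omega>"] R[OF that(1)] that(2) by (auto simp: a_def R_def)
    show "S \<omega> \<subseteq> closure (range (\<lambda>m. a m \<omega>))" if \<omega>: "\<omega> \<in> space M" for \<omega>
    proof
      fix s assume "s \<in> S \<omega>"
      then have s: "s \<in> R \<omega>" by (auto simp: R_def)
      show "s \<in> closure (range (\<lambda>m. a m \<omega>))"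
        unfolding closure_approachable
      proof (intro allI impI)
        fix e :: real assume "e > 0"
        then obtain d where d: "d \<in> D" "dist s d < e / 2"
          using D(2)[of "ball s (e / 2)"] by auto
        then obtain m where m: "from_nat_into D m = d"
          using D(1) from_nat_into_surj by metis
        have "dist d (a m \<omega>) \<le> dist d s"
          unfolding a_def m using R[OF \<omega>] s by (intro closest_point_le) auto
        then have "dist (a m \<omega>) s < e"
          using d(2) dist_triangle[of "a m \<omega>" s d] by (simp add: dist_commute)
        then show "\<exists>y\<in>range (\<lambda>m. a m \<omega>). dist y s < e" by blast
      qed
    qed
  qed
qed

section \<open>Extended real-valued expectations\<close>

text \<open>Nonemptiness matters: the empty supremum is 0 in \<open>ennreal\<close> but -infinity in
  \<open>ereal\<close>.\<close>

lemma enn2ereal_SUP: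
  assumes "I \<noteq> {}"
  shows "enn2ereal (SUP i\<in>I. f i) = (SUP i\<in>I. enn2ereal (f i))"
proof -
  obtain i where "i \<in> I" using assms by auto
  then have "0 \<le> (SUP i\<in>I. enn2ereal (f i))"
    by (rule SUP_upper2) simp
  then show ?thesis
    by (simp add: Sup_ennreal.rep_eq image_comp comp_def sup_absorb2)
qed

lemma ext_expectation_cong_AE:
  assumes "AE \<omega> in M. A \<omega> = B \<omega>"
  shows "ext_expectation M A = ext_expectation M B"
proof -
  have "(\<integral>\<^sup>+\<omega>. e2ennreal (A \<omega>) \<partial>M) = (\<integral>\<^sup>+\<omega>. e2ennreal (B \<omega>) \<partial>M)"
    "(\<integral>\<^sup>+\<omega>. e2ennreal (- A \<omega>) \<partial>M) = (\<integral>\<^sup>+\<omega>. e2ennreal (- B \<omega>) \<partial>M)"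
    by (intro nn_integral_cong_AE, use assms in eventually_elim, simp)+
  then show ?thesis by (simp add: ext_expectation_def)
qed

lemma ext_expectation_mono_AE:
  assumes "AE \<omega> in M. A \<omega> \<le> B \<omega>"
  shows "ext_expectation M A \<le> ext_expectation M B"
proof -
  have 1: "(\<integral>\<^sup>+\<omega>. e2ennreal (A \<omega>) \<partial>M) \<le> (\<integral>\<^sup>+\<omega>. e2ennreal (B \<omega>) \<partial>M)"
    by (intro nn_integral_mono_AE, use assms in eventually_elim) (simp add: e2ennreal_mono)
  have 2: "(\<integral>\<^sup>+\<omega>. e2ennreal (- B \<omega>) \<partial>M) \<le> (\<integral>\<^sup>+\<omega>. e2ennreal (- A \<omega>) \<partial>M)"
    by (intro nn_integral_mono_AE, use assms in eventually_elim) (simp add: e2ennreal_mono)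
  show ?thesis
    using 1 2 le_less_trans[OF 1, of \<infinity>]
    by (auto simp: ext_expectation_def less_eq_ennreal.rep_eq intro!: ereal_minus_mono)
qed

text \<open>An integrable function plus a nonnegative one is the form in which the convention does
  not spoil additivity; the exact evaluations below all reduce to it. The identity (k + n)^+ + k^- =
  (k + n)^- + k^+ + n is free of subtraction and can therefore be integrated in
  \<open>ennreal\<close>.\<close>

lemma ext_expectation_real_add_ennreal:
  assumes k[measurable]: "integrable M k" and n[measurable]: "n \<in> borel_measurable M"
    and A: "AE \<omega> in M. A \<omega> = ereal (k \<omega>) + enn2ereal (n \<omega>)"
  shows "ext_expectation M A = ereal (\<integral>\<omega>. k \<omega> \<partial>M) + enn2ereal (\<integral>\<^sup>+\<omega>. n \<omega> \<partial>M)"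
proof -
  let ?B = "\<lambda>\<omega>. ereal (k \<omega>) + enn2ereal (n \<omega>)"
  let ?P = "\<integral>\<^sup>+\<omega>. e2ennreal (?B \<omega>) \<partial>M" and ?N = "\<integral>\<^sup>+\<omega>. e2ennreal (- ?B \<omega>) \<partial>M"
    and ?kp = "\<integral>\<^sup>+\<omega>. ennreal (k \<omega>) \<partial>M" and ?km = "\<integral>\<^sup>+\<omega>. ennreal (- k \<omega>) \<partial>M"
    and ?I = "\<integral>\<^sup>+\<omega>. n \<omega> \<partial>M"
  have [measurable]: "k \<in> borel_measurable M" using k by auto
  have "e2ennreal (ereal r + enn2ereal s) + ennreal (- r)
      = e2ennreal (- (ereal r + enn2ereal s)) + (ennreal r + s)" for r s
  proof (cases s)
    case (real t)
    then have "enn2ereal s = ereal t" by (simp add: enn2ereal_ennreal)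
    with real show ?thesis
      by (cases "0 \<le> r"; cases "0 \<le> r + t")
        (auto simp: ennreal_neg ennreal_plus[symmetric] simp del: ennreal_plus)
  qed (simp add: ennreal_add_eq_top)
  then have "(\<integral>\<^sup>+\<omega>. e2ennreal (?B \<omega>) + ennreal (- k \<omega>) \<partial>M)
      = (\<integral>\<^sup>+\<omega>. e2ennreal (- ?B \<omega>) + (ennreal (k \<omega>) + n \<omega>) \<partial>M)"
    by simp
  then have eq: "?P + ?km = ?N + (?kp + ?I)"
    by (simp add: nn_integral_add)
  have fin: "?kp < \<top>" "?km < \<top>"
    using k by (auto simp: real_integrable_def less_top)
  \<comment> \<open>Adding \<open>n\<close> can only shrink the negative part, so it stays
    integrable and infinity minus infinity cannot occur.\<close>
  have "?N \<le> ?km"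
  proof (intro nn_integral_mono)
    fix \<omega>
    have "- ?B \<omega> \<le> ereal (- k \<omega>)"
      using enn2ereal_nonneg[of "n \<omega>"] by (cases "enn2ereal (n \<omega>)") auto
    then show "e2ennreal (- ?B \<omega>) \<le> ennreal (- k \<omega>)"
      using e2ennreal_mono[of "- ?B \<omega>" "ereal (- k \<omega>)"] by simp
  qed
  then have "?N < \<top>" using fin by (auto dest: le_less_trans)
  have int: "(\<integral>\<omega>. k \<omega> \<partial>M) = enn2real ?kp - enn2real ?km"
    using k by (rule real_lebesgue_integral_def)
  have "ext_expectation M A = ext_expectation M ?B"
    using A by (rule ext_expectation_cong_AE)
  also have "\<dots> = ereal (\<integral>\<omega>. k \<omega> \<partial>M) + enn2ereal ?I"
  proof (cases "?I = \<top>")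
    case True
    then have "?P = \<top>"
      using eq fin(2) by (auto simp: ennreal_add_eq_top)
    with True show ?thesis by (simp add: ext_expectation_def)
  next
    case False
    then have "?P \<noteq> \<top>"
      using eq[symmetric] False fin(1) \<open>?N < \<top>\<close> by (auto simp: ennreal_add_eq_top)
    have *: "\<exists>s\<ge>0. r = ennreal s" if "r \<noteq> \<top>" for r
      using that by (cases r) auto
    obtain p m a b i where r: "?P = ennreal p" "?N = ennreal m" "?kp = ennreal a" "?km = ennreal b"
      "?I = ennreal i" "0 \<le> p" "0 \<le> m" "0 \<le> a" "0 \<le> b" "0 \<le> i"
      using *[OF False] *[OF \<open>?P \<noteq> \<top>\<close>] 
        *[OF \<open>?N < \<top>\<close>[THEN less_imp_neq]] *[OF fin(1)[THEN less_imp_neq]]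
        *[OF fin(2)[THEN less_imp_neq]] by blast
    with eq have "p + b = m + (a + i)"
      by (simp add: ennreal_plus[symmetric] del: ennreal_plus)
    then show ?thesis
      unfolding ext_expectation_def int using r by (simp add: enn2ereal_ennreal)
  qed
  finally show ?thesis .
qed

lemma ext_expectation_real:
  assumes "integrable M k"
  shows "ext_expectation M (\<lambda>\<omega>. ereal (k \<omega>)) = ereal (\<integral>\<omega>. k \<omega> \<partial>M)"
  using ext_expectation_real_add_ennreal[OF assms, of "\<lambda>_. 0"] by (simp add: zero_ennreal.rep_eq)

text \<open>\<open>k\<close> is the positive part of \<open>A\<close>. Its integrability is all that
  the bound on the expectation provides, since the expectation may still be -infinity.\<close>

lemma ext_expectation_less_top_dominated:
  assumes "A \<in> borel_measurable M" "ext_expectation M A < \<infinity>"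
  obtains k where "integrable M k" "AE \<omega> in M. e2ennreal (A \<omega>) = ennreal (k \<omega>)"
    "AE \<omega> in M. A \<omega> \<le> ereal (k \<omega>)" "\<And>\<omega>. 0 \<le> k \<omega>"
proof
  note [measurable] = assms(1)
  let ?k = "\<lambda>\<omega>. enn2real (e2ennreal (A \<omega>))"
  have fin: "(\<integral>\<^sup>+\<omega>. e2ennreal (A \<omega>) \<partial>M) < \<infinity>"
    using assms(2) by (auto simp: ext_expectation_def split: if_splits)
  then have "AE \<omega> in M. e2ennreal (A \<omega>) \<noteq> \<infinity>"
    by (intro nn_integral_PInf_AE) auto
  then show *: "AE \<omega> in M. e2ennreal (A \<omega>) = ennreal (?k \<omega>)"
    by eventually_elim (simp add: less_top)
  show "integrable M ?k"
  proof (rule integrableI_nonneg)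
    have "(\<integral>\<^sup>+\<omega>. ennreal (?k \<omega>) \<partial>M) = (\<integral>\<^sup>+\<omega>. e2ennreal (A \<omega>) \<partial>M)"
      by (rule nn_integral_cong_AE, use * in eventually_elim) simp
    then show "(\<integral>\<^sup>+\<omega>. ennreal (?k \<omega>) \<partial>M) < \<infinity>" using fin by simp
  qed auto
  show "AE \<omega> in M. A \<omega> \<le> ereal (?k \<omega>)"
    using *
  proof eventually_elim
    fix \<omega> assume \<omega>: "e2ennreal (A \<omega>) = ennreal (?k \<omega>)"
    show "A \<omega> \<le> ereal (?k \<omega>)"
    proof (cases "0 \<le> A \<omega>")
      case True
      then have "A \<omega> = enn2ereal (ennreal (?k \<omega>))"
        using \<omega> by (simp add: enn2ereal_e2ennreal)
      then show ?thesis by (simp add: enn2ereal_ennreal)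
    next
      case False
      then show ?thesis by (meson enn2real_nonneg ereal_less_eq(5) le_cases order_trans)
    qed
  qed
qed auto

text \<open>Splitting \<open>A\<close> into its integrable positive part \<open>k\<close> and its
  negative part \<open>?n\<close> gives (c - k) + n, integrable plus nonnegative. Without
  \<open>fin\<close> the left side can be +infinity while the right side is -infinity.\<close>

lemma ext_expectation_real_minus:
  assumes c: "integrable M c" and A[measurable]: "A \<in> borel_measurable M"
    and fin: "ext_expectation M A < \<infinity>"
  shows "ext_expectation M (\<lambda>\<omega>. ereal (c \<omega>) - A \<omega>) = ereal (\<integral>\<omega>. c \<omega> \<partial>M) - ext_expectation M A"
proof -
  obtain k where k: "integrable M k" "AE \<omega> in M. e2ennreal (A \<omega>) = ennreal (k \<omega>)" "\<And>\<omega>. 0 \<le> k \<omega>"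
    using ext_expectation_less_top_dominated[OF A fin] by metis
  let ?n = "\<lambda>\<omega>. e2ennreal (- A \<omega>)"
  have "AE \<omega> in M. ereal (c \<omega>) - A \<omega> = ereal (c \<omega> - k \<omega>) + enn2ereal (?n \<omega>)"
    using k(2)
  proof eventually_elim
    fix \<omega> assume *: "e2ennreal (A \<omega>) = ennreal (k \<omega>)"
    show "ereal (c \<omega>) - A \<omega> = ereal (c \<omega> - k \<omega>) + enn2ereal (?n \<omega>)"
    proof (cases "0 \<le> A \<omega>")
      case True
      then have "A \<omega> = enn2ereal (ennreal (k \<omega>))" using * by (metis enn2ereal_e2ennreal)
      then have "A \<omega> = ereal (k \<omega>)" using k(3) by (simp add: enn2ereal_ennreal)
      then show ?thesis using k(3)[of \<omega>] by (simp add: ennreal_neg zero_ennreal.rep_eq)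
    next
      case False
      then have "k \<omega> = 0"
        using * k(3)[of \<omega>] by (simp add: e2ennreal_neg)
      moreover have "0 \<le> - A \<omega>" using False by (cases "A \<omega>") auto
      ultimately show ?thesis by (simp add: enn2ereal_e2ennreal minus_ereal_def)
    qed
  qed
  then have "ext_expectation M (\<lambda>\<omega>. ereal (c \<omega>) - A \<omega>)
      = ereal (\<integral>\<omega>. c \<omega> - k \<omega> \<partial>M) + enn2ereal (\<integral>\<^sup>+\<omega>. ?n \<omega> \<partial>M)"
    using c k(1) by (intro ext_expectation_real_add_ennreal) auto
  moreover have "(\<integral>\<^sup>+\<omega>. e2ennreal (A \<omega>) \<partial>M) = ennreal (\<integral>\<omega>. k \<omega> \<partial>M)"
    using nn_integral_cong_AE[OF k(2)] k(1,3) by (simp add: nn_integral_eq_integral)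
  moreover have "0 \<le> (\<integral>\<omega>. k \<omega> \<partial>M)" using k(3) by simp
  ultimately show ?thesis
    using c k(1) by (cases "enn2ereal (\<integral>\<^sup>+\<omega>. ?n \<omega> \<partial>M)")
      (auto simp: ext_expectation_def enn2ereal_ennreal)
qed

text \<open>Subtracting the integrable minorant \<open>k\<close> reduces this to monotone
  convergence for nonnegative functions.\<close>

lemma ext_expectation_monotone_convergence:
  fixes A :: "nat \<Rightarrow> 'a \<Rightarrow> ereal"
  assumes k: "integrable M k" and [measurable]: "\<And>m. A m \<in> borel_measurable M"
    and lb: "AE \<omega> in M. ereal (k \<omega>) \<le> A 0 \<omega>" and inc: "\<And>m. AE \<omega> in M. A m \<omega> \<le> A (Suc m) \<omega>"
  shows "ext_expectation M (\<lambda>\<omega>. SUP m. A m \<omega>) = (SUP m. ext_expectation M (A m))"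
proof -
  have [measurable]: "k \<in> borel_measurable M" using k by auto
  define n where "n m \<omega> = e2ennreal (A m \<omega> - ereal (k \<omega>))" for m \<omega>
  have [measurable]: "n m \<in> borel_measurable M" for m
    unfolding n_def[abs_def] by measurable
  have "AE \<omega> in M. \<forall>m. A m \<omega> \<le> A (Suc m) \<omega>" using inc by (simp add: AE_all_countable)
  then have dec: "AE \<omega> in M. \<forall>m. A m \<omega> = ereal (k \<omega>) + enn2ereal (n m \<omega>)"
    using lb
  proof eventually_elim
    fix \<omega> assume inc: "\<forall>m. A m \<omega> \<le> A (Suc m) \<omega>" and lb: "ereal (k \<omega>) \<le> A 0 \<omega>"
    show "\<forall>m. A m \<omega> = ereal (k \<omega>) + enn2ereal (n m \<omega>)"
    proof
      fix m
      have "A 0 \<omega> \<le> A m \<omega>" using lift_Suc_mono_le[of "\<lambda>m. A m \<omega>" 0 m] inc by simp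
      then have "0 \<le> A m \<omega> - ereal (k \<omega>)" using lb by (simp add: ereal_diff_positive)
      then show "A m \<omega> = ereal (k \<omega>) + enn2ereal (n m \<omega>)"
        unfolding n_def by (subst enn2ereal_e2ennreal) (cases "A m \<omega>"; simp)+
    qed
  qed
  then have each: "ext_expectation M (A m) = ereal (\<integral>\<omega>. k \<omega> \<partial>M) + enn2ereal (\<integral>\<^sup>+\<omega>. n m \<omega> \<partial>M)" for m
    by (intro ext_expectation_real_add_ennreal k) auto
  have "AE \<omega> in M. (SUP m. A m \<omega>) = ereal (k \<omega>) + enn2ereal (SUP m. n m \<omega>)"
    using dec by eventually_elim (simp add: enn2ereal_SUP SUP_ereal_add_right)
  then have "ext_expectation M (\<lambda>\<omega>. SUP m. A m \<omega>)
      = ereal (\<integral>\<omega>. k \<omega> \<partial>M) + enn2ereal (\<integral>\<^sup>+\<omega>. (SUP m. n m \<omega>) \<partial>M)"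
    by (intro ext_expectation_real_add_ennreal k) auto
  also have "(\<integral>\<^sup>+\<omega>. (SUP m. n m \<omega>) \<partial>M) = (SUP m. \<integral>\<^sup>+\<omega>. n m \<omega> \<partial>M)"
  proof (rule nn_integral_monotone_convergence_SUP_AE)
    show "AE \<omega> in M. n m \<omega> \<le> n (Suc m) \<omega>" for m
      using inc[of m] by eventually_elim (auto simp: n_def intro!: e2ennreal_mono ereal_minus_mono)
  qed auto
  finally show ?thesis
    by (simp add: each enn2ereal_SUP SUP_ereal_add_right)
qed

section \<open>Interchange of supremum and expectation\<close>

text \<open>A sublevel event at a real level \<open>r\<close> says that the measurable point
  \<open>(z \<omega>, r)\<close> lies in the closed epigraph; the level -infinity is a countable
  intersection of such events.\<close>

lemma measurable_normal_integrand:
  fixes g :: "'b::second_countable_topology \<Rightarrow> 'a \<Rightarrow> ereal"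
  assumes meas: "measurable_set_valued M (\<lambda>\<omega>. ereal_epigraph (\<lambda>z. g z \<omega>))"
    and lsc: "\<And>\<omega>. \<omega> \<in> space M \<Longrightarrow> lower_semicontinuous (\<lambda>z. g z \<omega>)"
    and z[measurable]: "z \<in> borel_measurable M"
  shows "(\<lambda>\<omega>. g (z \<omega>) \<omega>) \<in> borel_measurable M"
  unfolding borel_measurable_iff_Iic_ereal
proof
  fix c :: ereal
  have real: "{\<omega> \<in> space M. g (z \<omega>) \<omega> \<le> ereal r} \<in> sets M" for r
  proof -
    have "{\<omega> \<in> space M. (z \<omega>, r) \<in> ereal_epigraph (\<lambda>z. g z \<omega>)} \<in> sets M"
      by (rule measurable_mem_closed_set_valued[OF meas])
        (auto intro: closed_ereal_epigraph lsc)
    then show ?thesis by (simp add: ereal_epigraph_def)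
  qed
  have "{\<omega> \<in> space M. g (z \<omega>) \<omega> \<le> c} \<in> sets M"
  proof (cases c)
    case MInf
    have "g (z \<omega>) \<omega> \<le> - \<infinity> \<longleftrightarrow> (\<forall>m::nat. g (z \<omega>) \<omega> \<le> ereal (- real m))" for \<omega>
    proof (cases "g (z \<omega>) \<omega>")
      case (real r)
      obtain m where "- r < real m" using reals_Archimedean2 by blast
      with real show ?thesis by (auto intro!: exI[of _ m] simp: not_le)
    qed auto
    then have "{\<omega> \<in> space M. g (z \<omega>) \<omega> \<le> c}
        = (\<Inter>m::nat. {\<omega> \<in> space M. g (z \<omega>) \<omega> \<le> ereal (- real m)})"
      unfolding MInf by blast
    also have "\<dots> \<in> sets M" using real by blast
    finally show ?thesis .
  qed (use real in auto)
  then show "(\<lambda>\<omega>. g (z \<omega>) \<omega>) -` {..c} \<inter> space M \<in> sets M"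
    by (simp add: vimage_def Int_def conj_commute)
qed

text \<open>
  Splicing in bounded pieces of a Castaing representation of the epigraph, whenever they increase
  the value, drives \<open>w m\<close> up to the pointwise supremum without leaving the decomposable set \<open>W\<close>;
  no measurable selection of an approximate maximizer is needed.
\<close>

lemma decomposable_maximizing_sequence:
  fixes g :: "'b::euclidean_space \<Rightarrow> 'a \<Rightarrow> ereal"
  assumes meas: "measurable_set_valued M (\<lambda>\<omega>. ereal_epigraph (\<lambda>z. g z \<omega>))"
    and lsc: "\<And>\<omega>. \<omega> \<in> space M \<Longrightarrow> lower_semicontinuous (\<lambda>z. g z \<omega>)"
    and conv: "\<And>\<omega>. \<omega> \<in> space M \<Longrightarrow> convex_function (\<lambda>z. g z \<omega>)"
    and v[measurable]: "v \<in> borel_measurable M"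
    and W: "W \<subseteq> borel_measurable M" "w0 \<in> W"
    and splice: "\<And>w b C A. w \<in> W \<Longrightarrow> b \<in> borel_measurable M \<Longrightarrow> (\<And>\<omega>. norm (b \<omega>) \<le> C) \<Longrightarrow>
      A \<in> sets M \<Longrightarrow> (\<lambda>\<omega>. if \<omega> \<in> A then b \<omega> else w \<omega>) \<in> W"
  obtains w :: "nat \<Rightarrow> 'a \<Rightarrow> 'b" where "\<And>m. w m \<in> W" "w 0 = w0"
    "\<And>\<omega> m. \<omega> \<in> space M \<Longrightarrow>
      ereal (w m \<omega> \<bullet> v \<omega>) - g (w m \<omega>) \<omega> \<le> ereal (w (Suc m) \<omega> \<bullet> v \<omega>) - g (w (Suc m) \<omega>) \<omega>"
    "\<And>\<omega>. \<omega> \<in> space M \<Longrightarrow>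
      (SUP m. ereal (w m \<omega> \<bullet> v \<omega>) - g (w m \<omega>) \<omega>) = (SUP z. ereal (z \<bullet> v \<omega>) - g z \<omega>)"
proof -
  define h where "h z \<omega> = ereal (z \<bullet> v \<omega>) - g z \<omega>" for z \<omega>
  obtain a :: "nat \<Rightarrow> 'a \<Rightarrow> 'b \<times> real" where a: "\<And>m. a m \<in> borel_measurable M"
    "\<And>\<omega> m. \<omega> \<in> space M \<Longrightarrow> ereal_epigraph (\<lambda>z. g z \<omega>) \<noteq> {} \<Longrightarrow> a m \<omega> \<in> ereal_epigraph (\<lambda>z. g z \<omega>)"
    "\<And>\<omega>. \<omega> \<in> space M \<Longrightarrow> ereal_epigraph (\<lambda>z. g z \<omega>) \<subseteq> closure (range (\<lambda>m. a m \<omega>))"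
  proof (rule Castaing_representation[OF meas])
    show "closed (ereal_epigraph (\<lambda>z. g z \<omega>)) \<and> convex (ereal_epigraph (\<lambda>z. g z \<omega>))"
      if "\<omega> \<in> space M" for \<omega>
      using closed_ereal_epigraph[OF lsc[OF that]] conv[OF that] by (simp add: convex_function_def)
  qed blast
  define b where "b i \<omega> = fst (a i \<omega>)" for i \<omega>
  have b_meas[measurable]: "b i \<in> borel_measurable M" for i
    unfolding b_def[abs_def] 
    by (rule measurable_compose[OF a(1) borel_measurable_continuous_onI])
      (intro continuous_intros)
  \<comment> \<open>The event on which the i-th piece is a strict improvement and is small enough to
    be inserted.\<close>
  define A where "A i k w = {\<omega> \<in> space M. norm (b i \<omega>) \<le> real k \<and> h (w \<omega>) \<omega> < h (b i \<omega>) \<omega>}" for i k w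
  \<comment> \<open>Each pair (i, k) gets exactly one turn. That is enough because the values never
    decrease afterwards.\<close>
  define w where "w = rec_nat w0 (\<lambda>m w \<omega>. case prod_decode m of (i, k) \<Rightarrow>
    if \<omega> \<in> A i k w then b i \<omega> else w \<omega>)"
  have w_0: "w 0 = w0" by (simp add: w_def)
  have w_Suc: "w (Suc m) \<omega> = (if \<omega> \<in> A i k (w m) then b i \<omega> else w m \<omega>)"
    if "prod_decode m = (i, k)" for m i k \<omega>
    using that by (simp add: w_def)
  have h_meas: "(\<lambda>\<omega>. h (z \<omega>) \<omega>) \<in> borel_measurable M" if [measurable]: "z \<in> borel_measurable M" for z
  proof -
    have [measurable]: "(\<lambda>\<omega>. g (z \<omega>) \<omega>) \<in> borel_measurable M"
      by (rule measurable_normal_integrand[OF meas lsc that])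
    show ?thesis unfolding h_def by measurable
  qed
  have w_W: "w m \<in> W" for m
  proof (induction m)
    case (Suc m)
    obtain i k where ik: "prod_decode m = (i, k)" by fastforce
    \<comment> \<open>\<open>splice\<close> asks for a bound everywhere; cutting \<open>b i\<close>
      off to 0 provides it without changing \<open>b i\<close> on
      \<open>A i k (w m)\<close>.\<close>
    let ?c = "\<lambda>\<omega>. if norm (b i \<omega>) \<le> real k then b i \<omega> else 0"
    have "w m \<in> borel_measurable M" using Suc W by auto
    note [measurable] = h_meas[OF this] h_meas[OF b_meas]
    have "A i k (w m) \<in> sets M" unfolding A_def by measurable
    then have "(\<lambda>\<omega>. if \<omega> \<in> A i k (w m) then ?c \<omega> else w m \<omega>) \<in> W"
      by (intro splice[OF Suc, of ?c "real k"]) auto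
    moreover have "w (Suc m) = (\<lambda>\<omega>. if \<omega> \<in> A i k (w m) then ?c \<omega> else w m \<omega>)"
      by (auto simp: w_Suc[OF ik] A_def)
    ultimately show ?case by simp
  qed (simp add: w_0 W)
  have w_inc: "h (w m \<omega>) \<omega> \<le> h (w (Suc m) \<omega>) \<omega>" for m \<omega>
  proof -
    obtain i k where ik: "prod_decode m = (i, k)" by fastforce
    show ?thesis by (auto simp: w_Suc[OF ik] A_def)
  qed
  have w_sup: "(SUP m. h (w m \<omega>) \<omega>) = (SUP z. h z \<omega>)" if \<omega>: "\<omega> \<in> space M" for \<omega>
  proof (rule antisym)
    let ?s = "SUP m. h (w m \<omega>) \<omega>" and ?E = "ereal_epigraph (\<lambda>z. g z \<omega>)"
    show "?s \<le> (SUP z. h z \<omega>)"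
      by (rule SUP_least) (rule SUP_upper[OF UNIV_I, of "\<lambda>z. h z \<omega>"])
    have b_le: "h (b i \<omega>) \<omega> \<le> ?s" for i
    proof -
      \<comment> \<open>The truncation level may depend on \<open>\<omega>\<close>, since the
        supremum is compared pointwise.\<close>
      obtain k where k: "norm (b i \<omega>) \<le> real k" using real_arch_simple by blast
      have "h (b i \<omega>) \<omega> \<le> h (w (Suc (prod_encode (i, k))) \<omega>) \<omega>"
        using k \<omega> by (auto simp: w_Suc[of _ i k] A_def)
      also have "\<dots> \<le> ?s" by (rule SUP_upper) simp
      finally show ?thesis .
    qed
    have epi_le: "ereal (z \<bullet> v \<omega> - r) \<le> ?s" if zr: "(z, r) \<in> ?E" for z r
    proof -
      \<comment> \<open>A closed set containing the whole sequence \<open>a\<close> at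
        \<open>\<omega>\<close>, hence the epigraph in its closure.\<close>
      let ?C = "{q :: 'b \<times> real. ereal (fst q \<bullet> v \<omega> - snd q) \<le> ?s}"
      have "a i \<omega> \<in> ?C" for i
      proof -
        have "a i \<omega> \<in> ?E" using a(2)[OF \<omega>] zr by blast
        then have "g (b i \<omega>) \<omega> \<le> ereal (snd (a i \<omega>))"
          by (auto simp: ereal_epigraph_def b_def split: prod.splits)
        then have "ereal (b i \<omega> \<bullet> v \<omega> - snd (a i \<omega>)) \<le> h (b i \<omega>) \<omega>"
          unfolding h_def by (cases "g (b i \<omega>) \<omega>") auto
        also have "\<dots> \<le> ?s" by (rule b_le)
        finally show ?thesis by (simp add: b_def)
      qed
      moreover have "closed ?C"
        by (intro closed_Collect_le continuous_intros)
      ultimately have "closure (range (\<lambda>m. a m \<omega>)) \<subseteq> ?C"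
        by (intro closure_minimal) auto
      then show ?thesis using a(3)[OF \<omega>] zr by auto
    qed
    show "(SUP z. h z \<omega>) \<le> ?s"
    proof (rule SUP_least)
      fix z
      show "h z \<omega> \<le> ?s"
      proof (cases "g z \<omega>")
        case (real r)
        then show ?thesis using epi_le[of z r] by (simp add: h_def ereal_epigraph_def)
      next
        case MInf
        \<comment> \<open>Over such a \<open>z\<close> the epigraph contains the entire vertical
          line; the height is chosen so that the affine value is exactly \<open>B\<close>.\<close>
        have "?s = \<infinity>"
        proof (rule ereal_top)
          fix B :: real
          show "ereal B \<le> ?s"
            using epi_le[of z "z \<bullet> v \<omega> - B"] MInf by (simp add: ereal_epigraph_def)
        qed
        then show ?thesis by simp
      qed (simp add: h_def)
    qed
  qed
  show ?thesis
    by (rule that[of w]) (use w_W w_0 w_inc w_sup in \<open>auto simp: h_def\<close>)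
qed

text \<open>\<open>W\<close> is abstract, with \<open>splice\<close> standing for decomposability,
  so that pairs of processes with values in a product space can be inserted.\<close>

lemma interchange_conjugate:
  fixes g :: "'b::euclidean_space \<Rightarrow> 'a \<Rightarrow> ereal"
  assumes meas: "measurable_set_valued M (\<lambda>\<omega>. ereal_epigraph (\<lambda>z. g z \<omega>))"
    and lsc: "\<And>\<omega>. \<omega> \<in> space M \<Longrightarrow> lower_semicontinuous (\<lambda>z. g z \<omega>)"
    and conv: "\<And>\<omega>. \<omega> \<in> space M \<Longrightarrow> convex_function (\<lambda>z. g z \<omega>)"
    and v: "v \<in> borel_measurable M"
    and W: "W \<subseteq> borel_measurable M" "w0 \<in> W"
    and splice: "\<And>w b C A. w \<in> W \<Longrightarrow> b \<in> borel_measurable M \<Longrightarrow> (\<And>\<omega>. norm (b \<omega>) \<le> C) \<Longrightarrow>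
      A \<in> sets M \<Longrightarrow> (\<lambda>\<omega>. if \<omega> \<in> A then b \<omega> else w \<omega>) \<in> W"
    and int: "\<And>w. w \<in> W \<Longrightarrow> integrable M (\<lambda>\<omega>. w \<omega> \<bullet> v \<omega>)"
    and fin: "ext_expectation M (\<lambda>\<omega>. g (w0 \<omega>) \<omega>) < \<infinity>"
  shows "(SUP w\<in>W. ereal (\<integral>\<omega>. w \<omega> \<bullet> v \<omega> \<partial>M) - ext_expectation M (\<lambda>\<omega>. g (w \<omega>) \<omega>))
    = ext_expectation M (\<lambda>\<omega>. SUP z. ereal (z \<bullet> v \<omega>) - g z \<omega>)"
proof (rule antisym)
  let ?h = "\<lambda>w \<omega>. ereal (w \<omega> \<bullet> v \<omega>) - g (w \<omega>) \<omega>"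
    and ?\<psi> = "\<lambda>\<omega>. SUP z. ereal (z \<bullet> v \<omega>) - g z \<omega>"
    and ?J = "\<lambda>w. ereal (\<integral>\<omega>. w \<omega> \<bullet> v \<omega> \<partial>M) - ext_expectation M (\<lambda>\<omega>. g (w \<omega>) \<omega>)"
  have g_meas: "(\<lambda>\<omega>. g (w \<omega>) \<omega>) \<in> borel_measurable M" if "w \<in> W" for w
    by (rule measurable_normal_integrand[OF meas lsc]) (use that W in auto)
  have J_eq: "ext_expectation M (?h w) = ?J w"
    if "w \<in> W" "ext_expectation M (\<lambda>\<omega>. g (w \<omega>) \<omega>) < \<infinity>" for w
    using ext_expectation_real_minus[OF int[OF that(1)] g_meas[OF that(1)] that(2)] .
  show "(SUP w\<in>W. ?J w) \<le> ext_expectation M ?\<psi>"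
  proof (rule SUP_least)
    fix w assume w: "w \<in> W"
    show "?J w \<le> ext_expectation M ?\<psi>"
    \<comment> \<open>If the expectation of \<open>g\<close> is infinite, \<open>?J w\<close> is
      -infinity and nothing is to be shown.\<close>
    proof (cases "ext_expectation M (\<lambda>\<omega>. g (w \<omega>) \<omega>) < \<infinity>")
      case True
      have "ext_expectation M (?h w) \<le> ext_expectation M ?\<psi>"
        by (intro ext_expectation_mono_AE AE_I2 SUP_upper) simp
      then show ?thesis using J_eq[OF w True] by simp
    qed simp
  qed
  show "ext_expectation M ?\<psi> \<le> (SUP w\<in>W. ?J w)"
  proof -
    obtain w where w: "\<And>m. w m \<in> W" "w 0 = w0"
      "\<And>\<omega> m. \<omega> \<in> space M \<Longrightarrow> ?h (w m) \<omega> \<le> ?h (w (Suc m)) \<omega>"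
      "\<And>\<omega>. \<omega> \<in> space M \<Longrightarrow> (SUP m. ?h (w m) \<omega>) = ?\<psi> \<omega>"
    proof (rule decomposable_maximizing_sequence[OF meas lsc conv v W])
      show "(\<lambda>\<omega>. if \<omega> \<in> A then b \<omega> else w \<omega>) \<in> W"
        if "w \<in> W" "b \<in> borel_measurable M" "\<And>\<omega>. norm (b \<omega>) \<le> C" "A \<in> sets M" for w b C A
        by (rule splice[OF that])
    qed (assumption, assumption, rule that)
    obtain k0 where k0: "integrable M k0" "AE \<omega> in M. g (w0 \<omega>) \<omega> \<le> ereal (k0 \<omega>)"
      using ext_expectation_less_top_dominated[OF g_meas[OF W(2)] fin] by metis
    let ?k = "\<lambda>\<omega>. w0 \<omega> \<bullet> v \<omega> - k0 \<omega>"
    have k: "integrable M ?k" using int[OF W(2)] k0(1) by simp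
    have lb: "AE \<omega> in M. ereal (?k \<omega>) \<le> ?h (w 0) \<omega>"
      using k0(2) unfolding w(2)
    proof eventually_elim
      fix \<omega> assume "g (w0 \<omega>) \<omega> \<le> ereal (k0 \<omega>)"
      then show "ereal (?k \<omega>) \<le> ?h w0 \<omega>" by (cases "g (w0 \<omega>) \<omega>") auto
    qed
    \<comment> \<open>The minorant \<open>?k\<close> of \<open>?h (w m)\<close> is rearranged into
      an integrable majorant of \<open>g\<close> along \<open>w m\<close>.\<close>
    have "ext_expectation M (\<lambda>\<omega>. g (w m \<omega>) \<omega>) < \<infinity>" for m
    proof -
      have int': "integrable M (\<lambda>\<omega>. w m \<omega> \<bullet> v \<omega> - ?k \<omega>)"
        using int[OF w(1)] k by (rule Bochner_Integration.integrable_diff)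
      have "AE \<omega> in M. g (w m \<omega>) \<omega> \<le> ereal (w m \<omega> \<bullet> v \<omega> - ?k \<omega>)"
        using lb AE_space
      proof eventually_elim
        fix \<omega> assume \<omega>: "ereal (?k \<omega>) \<le> ?h (w 0) \<omega>" "\<omega> \<in> space M"
        have "?h (w 0) \<omega> \<le> ?h (w m) \<omega>"
          by (rule lift_Suc_mono_le[of "\<lambda>m. ?h (w m) \<omega>" 0 m]) (use w(3)[OF \<omega>(2)] in auto)
        then have "ereal (?k \<omega>) \<le> ?h (w m) \<omega>" using \<omega>(1) by (rule order_trans[rotated])
        then show "g (w m \<omega>) \<omega> \<le> ereal (w m \<omega> \<bullet> v \<omega> - ?k \<omega>)"
          by (cases "g (w m \<omega>) \<omega>") auto
      qed
      then have "ext_expectation M (\<lambda>\<omega>. g (w m \<omega>) \<omega>) \<le> ereal (\<integral>\<omega>. w m \<omega> \<bullet> v \<omega> - ?k \<omega> \<partial>M)"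
        unfolding ext_expectation_real[OF int', symmetric] by (rule ext_expectation_mono_AE)
      also have "\<dots> < \<infinity>" by simp
      finally show ?thesis .
    qed
    then have J: "ext_expectation M (?h (w m)) = ?J (w m)" for m
      by (intro J_eq w)
    have "ext_expectation M ?\<psi> = ext_expectation M (\<lambda>\<omega>. SUP m. ?h (w m) \<omega>)"
      by (intro ext_expectation_cong_AE AE_I2) (simp add: w(4))
    also have "\<dots> = (SUP m. ext_expectation M (?h (w m)))"
    proof (rule ext_expectation_monotone_convergence[where A = "\<lambda>m. ?h (w m)", OF k _ lb])
      show "?h (w m) \<in> borel_measurable M" for m
        using g_meas[OF w(1)] borel_measurable_integrable[OF int[OF w(1)]] by measurable
    qed (use w(3) in auto)
    also have "\<dots> \<le> (SUP w\<in>W. ?J w)"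
      unfolding J by (rule SUP_least) (rule SUP_upper[OF w(1)])
    finally show ?thesis .
  qed
qed

text \<open>Decomposability produces a function vanishing off \<open>space M\<close>, whereas the
  spliced one keeps the values of \<open>u\<close> there. Both agree on \<open>space M\<close>, and
  solidity bridges the difference.\<close>

lemma solid_decomposable_splice:
  assumes "solid_decomposable_space M U" "u \<in> U" "A \<in> sets M"
    and b[measurable]: "b \<in> borel_measurable M" and bd: "\<And>\<omega>. norm (b \<omega>) \<le> C"
  shows "(\<lambda>\<omega>. if \<omega> \<in> A then b \<omega> else u \<omega>) \<in> U"
proof -
  have [measurable]: "u \<in> borel_measurable M" "A \<in> sets M"
    using assms by (auto simp: solid_decomposable_space_def rv_linear_space_def)
  have "b \<in> ess_bounded M" using b bd by (auto simp: ess_bounded_def)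
  then have "(\<lambda>\<omega>. indicator (space M - A) \<omega> *\<^sub>R u \<omega>
      + indicator (space M - (space M - A)) \<omega> *\<^sub>R b \<omega>) \<in> U" (is "?w \<in> U")
    using assms(1-3) by (simp add: solid_decomposable_space_def decomposable_def)
  moreover have "AE \<omega> in M. \<forall>i. \<bar>(if \<omega> \<in> A then b \<omega> else u \<omega>) $ i\<bar> \<le> \<bar>?w \<omega> $ i\<bar>"
    by (auto split: split_indicator)
  moreover have "(\<lambda>\<omega>. if \<omega> \<in> A then b \<omega> else u \<omega>) \<in> borel_measurable M"
    by measurable
  ultimately show ?thesis
    using assms(1) by (simp add: solid_decomposable_space_def solid_def)
qed

text \<open>The interchange on the product space: a bounded splice of a pair acts componentwise,
  because the norm of a pair bounds both components.\<close>

lemma integral_functional_conjugate: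
  fixes f :: "real ^ 'n \<Rightarrow> real ^ 'm \<Rightarrow> 'a \<Rightarrow> ereal"
  assumes f: "convex_normal_integrand M f"
    and X: "solid_decomposable_space M X" and U: "solid_decomposable_space M U"
    and p: "p \<in> borel_measurable M" "\<And>x. x \<in> X \<Longrightarrow> integrable M (\<lambda>\<omega>. x \<omega> \<bullet> p \<omega>)"
    and y: "y \<in> borel_measurable M" "\<And>u. u \<in> U \<Longrightarrow> integrable M (\<lambda>\<omega>. u \<omega> \<bullet> y \<omega>)"
    and dom: "x0 \<in> X" "u0 \<in> U" "integral_functional M f x0 u0 < \<infinity>"
  shows "(SUP (x, u) \<in> X \<times> U. ereal (pairing M x p + pairing M u y) - integral_functional M f x u)
    = integral_functional M (conjugate_integrand f) p y"
proof -
  let ?g = "\<lambda>z \<omega>. f (fst z) (snd z) \<omega>" and ?v = "\<lambda>\<omega>. (p \<omega>, y \<omega>)"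
  let ?W = "(\<lambda>(x, u) \<omega>. (x \<omega>, u \<omega>)) ` (X \<times> U)"
  have W_iff: "w \<in> ?W \<longleftrightarrow> (\<lambda>\<omega>. fst (w \<omega>)) \<in> X \<and> (\<lambda>\<omega>. snd (w \<omega>)) \<in> U" for w
    by (force simp: image_iff)
  have X_meas: "X \<subseteq> borel_measurable M" and U_meas: "U \<subseteq> borel_measurable M"
    using X U by (auto simp: solid_decomposable_space_def rv_linear_space_def)
  have 1: "(SUP w\<in>?W. ereal (\<integral>\<omega>. w \<omega> \<bullet> ?v \<omega> \<partial>M) - ext_expectation M (\<lambda>\<omega>. ?g (w \<omega>) \<omega>))
      = ext_expectation M (\<lambda>\<omega>. SUP z. ereal (z \<bullet> ?v \<omega>) - ?g z \<omega>)"
  proof (rule interchange_conjugate[where ?w0.0 = "\<lambda>\<omega>. (x0 \<omega>, u0 \<omega>)"])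
    show "measurable_set_valued M (\<lambda>\<omega>. ereal_epigraph (\<lambda>z. ?g z \<omega>))"
      "\<And>\<omega>. \<omega> \<in> space M \<Longrightarrow> lower_semicontinuous (\<lambda>z. ?g z \<omega>)"
      "\<And>\<omega>. \<omega> \<in> space M \<Longrightarrow> convex_function (\<lambda>z. ?g z \<omega>)"
      using f by (auto simp: convex_normal_integrand_def closed_function_def case_prod_unfold)
    show "?v \<in> borel_measurable M" using p(1) y(1) by (rule borel_measurable_Pair)
    show "?W \<subseteq> borel_measurable M"
      using X_meas U_meas by (auto intro!: borel_measurable_Pair)
    show "(\<lambda>\<omega>. (x0 \<omega>, u0 \<omega>)) \<in> ?W" using dom by (simp add: W_iff)
    show "(\<lambda>\<omega>. if \<omega> \<in> A then b \<omega> else w \<omega>) \<in> ?W"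
      if w: "w \<in> ?W" and b: "b \<in> borel_measurable M" "\<And>\<omega>. norm (b \<omega>) \<le> C" and A: "A \<in> sets M"
      for w b C A
    proof -
      have "norm (fst (b \<omega>)) \<le> C" "norm (snd (b \<omega>)) \<le> C" for \<omega>
        using b(2)[of \<omega>] norm_fst_le[of "fst (b \<omega>)" "snd (b \<omega>)"]
          norm_snd_le[of "snd (b \<omega>)" "fst (b \<omega>)"] by auto
      moreover have "(\<lambda>\<omega>. fst (b \<omega>)) \<in> borel_measurable M" "(\<lambda>\<omega>. snd (b \<omega>)) \<in> borel_measurable M"
        by (rule measurable_compose[OF b(1) borel_measurable_continuous_onI],
            intro continuous_intros)+
      ultimately have "(\<lambda>\<omega>. if \<omega> \<in> A then fst (b \<omega>) else fst (w \<omega>)) \<in> X"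
        and "(\<lambda>\<omega>. if \<omega> \<in> A then snd (b \<omega>) else snd (w \<omega>)) \<in> U"
        using w A by (auto simp: W_iff intro!: solid_decomposable_splice[OF X]
            solid_decomposable_splice[OF U])
      then show ?thesis by (simp add: W_iff if_distrib)
    qed
    show "integrable M (\<lambda>\<omega>. w \<omega> \<bullet> ?v \<omega>)" if "w \<in> ?W" for w
      using that p(2) y(2) by (auto simp: inner_prod_def)
    show "ext_expectation M (\<lambda>\<omega>. ?g (x0 \<omega>, u0 \<omega>) \<omega>) < \<infinity>"
      using dom(3) by (simp add: integral_functional_def)
  qed
  have 2: "(SUP w\<in>?W. ereal (\<integral>\<omega>. w \<omega> \<bullet> ?v \<omega> \<partial>M) - ext_expectation M (\<lambda>\<omega>. ?g (w \<omega>) \<omega>))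
    = (SUP (x, u) \<in> X \<times> U. ereal (pairing M x p + pairing M u y) - integral_functional M f x u)"
    unfolding image_comp
    by (rule SUP_cong) (auto simp: pairing_def integral_functional_def p(2) y(2))
  have 3: "ext_expectation M (\<lambda>\<omega>. SUP z. ereal (z \<bullet> ?v \<omega>) - ?g z \<omega>)
    = integral_functional M (conjugate_integrand f) p y"
    by (simp add: integral_functional_def conjugate_integrand_def case_prod_unfold inner_prod_def)
  show ?thesis
    by (rule trans[OF 2[symmetric] trans[OF 1 3]])
qed

section \<open>Adapted directions and the dual objective\<close>

lemma adapted_processes_scaleR:
  assumes "x \<in> adapted_processes M T F stage"
  shows "(\<lambda>\<omega>. c *\<^sub>R x \<omega>) \<in> adapted_processes M T F stage"
proof -
  obtain x' where x': "AE \<omega> in M. x \<omega> = x' \<omega>"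
    "\<And>t i. t \<le> T \<Longrightarrow> stage i = t \<Longrightarrow> (\<lambda>\<omega>. x' \<omega> $ i) \<in> borel_measurable (F t)"
    using assms by (auto simp: adapted_processes_def)
  have "AE \<omega> in M. c *\<^sub>R x \<omega> = c *\<^sub>R x' \<omega>"
    using x'(1) by eventually_elim simp
  moreover have "(\<lambda>\<omega>. (c *\<^sub>R x' \<omega>) $ i) \<in> borel_measurable (F (stage i))" if "stage i \<le> T" for i
    using x'(2)[OF that refl] by simp
  moreover have "(\<lambda>\<omega>. c *\<^sub>R x \<omega>) \<in> borel_measurable M"
    using assms by (auto simp: adapted_processes_def)
  ultimately show ?thesis
    unfolding adapted_processes_def by (auto intro!: exI[of _ "\<lambda>\<omega>. c *\<^sub>R x' \<omega>"])
qed

lemma zero_in_adapted_processes: "(\<lambda>\<omega>. 0) \<in> adapted_processes M T F stage"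
  unfolding adapted_processes_def by (auto intro!: exI[of _ "\<lambda>\<omega>. 0"])

theorem theorem14:
  fixes M :: "'a measure" and T :: nat and F :: "nat \<Rightarrow> 'a measure"
    and stage :: "'n::finite \<Rightarrow> nat"
    and f :: "real ^ 'n \<Rightarrow> real ^ 'm \<Rightarrow> 'a \<Rightarrow> ereal"
    and X V :: "('a \<Rightarrow> real ^ 'n) set" and U Y :: "('a \<Rightarrow> real ^ 'm) set"
    and ubar :: "'a \<Rightarrow> real ^ 'm"
  assumes "prob_space M"
    and "discrete_filtration M T F"
    and "\<And>i. stage i \<le> T"
    and "convex_normal_integrand M f"
    and "solid_decomposable_space M X" and "solid_decomposable_space M V"
    and "separating_duality M X V"
    and "solid_decomposable_space M U" and "solid_decomposable_space M Y"
    and "separating_duality M U Y"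
    and "ubar \<in> U"
    and "\<exists>x\<in>X. \<exists>u\<in>U. integral_functional M f x u < \<infinity>"
  shows "\<forall>p\<in>V. \<forall>y\<in>Y.
    ereal (pairing M ubar y)
        - perturbation_conjugate M X U (perturbation_function M (adapted_processes M T F stage) f) (\<lambda>\<omega>. 0) p y =
      (if p \<in> annihilator M V (X \<inter> adapted_processes M T F stage)
       then ereal (pairing M ubar y) - integral_functional M (conjugate_integrand f) p y
       else -\<infinity>)"
proof (intro ballI)
  fix p y assume p: "p \<in> V" and y: "y \<in> Y"
  let ?N = "adapted_processes M T F stage"
  let ?G = "perturbation_function M ?N f"
  let ?F = "perturbation_conjugate M X U ?G (\<lambda>\<omega>. 0) p y"
  let ?val = "\<lambda>x z u. ereal (pairing M x (\<lambda>\<omega>. 0) + pairing M z p + pairing M u y) - ?G x z u"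
  obtain x0 u0 where dom: "x0 \<in> X" "u0 \<in> U" "integral_functional M f x0 u0 < \<infinity>"
    using assms(12) by blast
  have int_p: "integrable M (\<lambda>\<omega>. x \<omega> \<bullet> p \<omega>)" if "x \<in> X" for x
    using assms(7) that p by (auto simp: separating_duality_def)
  have int_y: "integrable M (\<lambda>\<omega>. u \<omega> \<bullet> y \<omega>)" if "u \<in> U" for u
    using assms(10) that y by (auto simp: separating_duality_def)
  have meas: "p \<in> borel_measurable M" "y \<in> borel_measurable M"
    using assms(6,9) p y by (auto simp: solid_decomposable_space_def rv_linear_space_def)
  have scale: "(\<lambda>\<omega>. c *\<^sub>R x \<omega>) \<in> X" if "x \<in> X" for c x
    using assms(5) that by (auto simp: solid_decomposable_space_def rv_linear_space_def)
  have add: "(\<lambda>\<omega>. x \<omega> + x' \<omega>) \<in> X" if "x \<in> X" "x' \<in> X" for x x'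
    using assms(5) that by (auto simp: solid_decomposable_space_def rv_linear_space_def)
  have val_le: "?val x z u \<le> ?F" if "x \<in> X" "z \<in> X" "u \<in> U" for x z u
    unfolding perturbation_conjugate_def using that by (intro SUP_upper2[of "(x, z, u)"]) auto
  show "ereal (pairing M ubar y) - ?F =
      (if p \<in> annihilator M V (X \<inter> ?N)
       then ereal (pairing M ubar y) - integral_functional M (conjugate_integrand f) p y
       else -\<infinity>)"
  proof (cases "p \<in> annihilator M V (X \<inter> ?N)")
    case True
    let ?J = "\<lambda>x u. ereal (pairing M x p + pairing M u y) - integral_functional M f x u"
    have "?F = (SUP (x, u) \<in> X \<times> U. ?J x u)"
    proof (rule antisym)
      show "?F \<le> (SUP (x, u) \<in> X \<times> U. ?J x u)"
        unfolding perturbation_conjugate_def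
      proof (rule SUP_least, clarify)
        fix x z u assume xzu: "x \<in> X" "z \<in> X" "u \<in> U"
        show "?val x z u \<le> (SUP (x, u) \<in> X \<times> U. ?J x u)"
        proof (cases "(\<lambda>\<omega>. x \<omega> - z \<omega>) \<in> ?N")
          \<comment> \<open>The difference of \<open>x\<close> and \<open>z\<close> is adapted and
            in \<open>X\<close>, so \<open>p\<close> cannot distinguish \<open>z\<close> from
            \<open>x\<close>.\<close>
          case N: True
          have "(\<lambda>\<omega>. x \<omega> - z \<omega>) \<in> X"
            using add[OF xzu(1) scale[OF xzu(2), of "-1"]] by simp
          with N True have "pairing M (\<lambda>\<omega>. x \<omega> - z \<omega>) p = 0"
            by (auto simp: annihilator_def)
          then have "pairing M z p = pairing M x p"
            using int_p xzu by (simp add: pairing_def inner_diff_left)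
          then have "?val x z u = ?J x u"
            using N by (simp add: perturbation_function_def convex_indicator_def pairing_def)
          then show ?thesis using xzu by (intro SUP_upper2[of "(x, u)"]) auto
        qed (simp add: perturbation_function_def convex_indicator_def)
      qed
      show "(SUP (x, u) \<in> X \<times> U. ?J x u) \<le> ?F"
      proof (rule SUP_least, clarify)
        fix x u assume "x \<in> X" "u \<in> U"
        \<comment> \<open>The choice z = x is admissible because 0 is adapted.\<close>
        then show "?J x u \<le> ?F"
          using val_le[of x x u]
          by (simp add: perturbation_function_def convex_indicator_def zero_in_adapted_processes
              pairing_def)
      qed
    qed
    also have "\<dots> = integral_functional M (conjugate_integrand f) p y"
      by (rule integral_functional_conjugate[OF assms(4,5,8) meas(1) int_p meas(2) int_y dom])
    finally show ?thesis using True by simp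
  next
    case False
    then obtain w where w: "w \<in> X" "w \<in> ?N" "pairing M w p \<noteq> 0"
      using p by (auto simp: annihilator_def)
    have "?F = \<infinity>"
    proof (rule ereal_top)
      fix B :: real
      \<comment> \<open>The value at the domain point may be -infinity, hence a real upper bound in
        its place.\<close>
      obtain r where r: "integral_functional M f x0 u0 \<le> ereal r"
        using dom(3) by (cases "integral_functional M f x0 u0") auto
      \<comment> \<open>Solves <x0 + c w, p> + <u0, y> = B + r for \<open>c\<close>, so that
        subtracting at most \<open>r\<close> leaves at least \<open>B\<close>.\<close>
      define c where "c = (B + r - pairing M x0 p - pairing M u0 y) / pairing M w p"
      let ?z = "\<lambda>\<omega>. x0 \<omega> + c *\<^sub>R w \<omega>"
      have "?z \<in> X" using add[OF dom(1) scale[OF w(1)]] .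
      have "(\<lambda>\<omega>. x0 \<omega> - ?z \<omega>) \<in> ?N"
        using adapted_processes_scaleR[OF w(2), of "- c"] by simp
      then have "?G x0 ?z u0 = integral_functional M f x0 u0"
        by (simp add: perturbation_function_def convex_indicator_def)
      moreover have "pairing M ?z p + pairing M u0 y = B + r"
        using int_p[OF dom(1)] int_p[OF w(1)] w(3)
        by (simp add: pairing_def inner_add_left c_def)
      ultimately have "?val x0 ?z u0 = ereal (B + r) - integral_functional M f x0 u0"
        by (simp add: pairing_def)
      moreover have "ereal B \<le> ereal (B + r) - integral_functional M f x0 u0"
        using r by (cases "integral_functional M f x0 u0") auto
      ultimately show "ereal B \<le> ?F"
        using val_le[OF dom(1) \<open>?z \<in> X\<close> dom(2)] by simp
    qed
    with False show ?thesis by simp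
  qed
qed

end
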